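(* Let $E$ and $F$ be Banach lattices and let $T:E\to F$ be a uaw-Dunford–Pettis operator. Then $T$ is Dunford–Pettis if one of the following holds: (1) the lattice operations in $E$ are weakly sequentially continuous; (2) $E$ is discrete with an order continuous norm; (3) $T$ is positive and $F$ is discrete with an order continuous norm.
   Context: All operators are continuous linear operators. A net $(x_\alpha)$ in a Banach lattice $E$ is uaw-convergent to $x$ (written $x_\alpha\xrightarrow{uaw}x$) if $|x_\alpha-x|\wedge u\to 0$ weakly for every $u\in E_+$. An operator $T$ from a Banach lattice $E$ into a Banach space $X$ is uaw-Dunford–Pettis if for every norm bounded sequence $(x_n)$ in $E$ with $x_n\xrightarrow{uaw}0$ one has $\|Tx_n\|\to 0$. An operator is Dunford–Pettis if it maps weakly null sequences to norm null sequences. A Banach lattice has weakly sequentially continuous lattice operations if $x_n\to 0$ weakly implies $|x_n|\to 0$ weakly. *)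

theory Defs
  imports "HOL-Analysis.Analysis"
begin

class banach_lattice = banach + ordered_real_vector + lattice +
  assumes lattice_norm:
    "sup x (- x) \<le> sup y (- y) \<Longrightarrow> norm x \<le> norm y"

definition labs :: "'a::banach_lattice \<Rightarrow> 'a" where
  "labs x = sup x (- x)"

definition weakly_to :: "(nat \<Rightarrow> 'a::real_normed_vector) \<Rightarrow> 'a \<Rightarrow> bool" where
  "weakly_to xs x \<longleftrightarrow>
     (\<forall>f :: 'a \<Rightarrow> real. bounded_linear f \<longrightarrow> (\<lambda>n. f (xs n)) \<longlonglongrightarrow> f x)"

definition uaw_to :: "(nat \<Rightarrow> 'a::banach_lattice) \<Rightarrow> 'a \<Rightarrow> bool" where
  "uaw_to xs x \<longleftrightarrow>
     (\<forall>u. 0 \<le> u \<longrightarrow> weakly_to (\<lambda>n. inf (labs (xs n - x)) u) 0)"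

definition uaw_DP :: "('a::banach_lattice \<Rightarrow> 'b::real_normed_vector) \<Rightarrow> bool" where
  "uaw_DP T \<longleftrightarrow> bounded_linear T \<and>
     (\<forall>xs. bounded (range xs) \<longrightarrow> uaw_to xs 0 \<longrightarrow> (\<lambda>n. norm (T (xs n))) \<longlonglongrightarrow> 0)"

definition dunford_pettis :: "('a::real_normed_vector \<Rightarrow> 'b::real_normed_vector) \<Rightarrow> bool" where
  "dunford_pettis T \<longleftrightarrow> bounded_linear T \<and>
     (\<forall>xs. weakly_to xs 0 \<longrightarrow> (\<lambda>n. norm (T (xs n))) \<longlonglongrightarrow> 0)"

definition weakly_seq_cont_lattice_ops :: "'a::banach_lattice itself \<Rightarrow> bool" where
  "weakly_seq_cont_lattice_ops _ \<longleftrightarrow>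
     (\<forall>xs :: nat \<Rightarrow> 'a. weakly_to xs 0 \<longrightarrow> weakly_to (\<lambda>n. labs (xs n)) 0)"

definition atom :: "'a::banach_lattice \<Rightarrow> bool" where
  "atom a \<longleftrightarrow> 0 < a \<and> (\<forall>x. 0 \<le> x \<and> x \<le> a \<longrightarrow> (\<exists>c::real. x = c *\<^sub>R a))"

definition discrete_lattice :: "'a::banach_lattice itself \<Rightarrow> bool" where
  "discrete_lattice _ \<longleftrightarrow> (\<forall>x :: 'a. 0 < x \<longrightarrow> (\<exists>a. atom a \<and> a \<le> x))"

text \<open>Order continuous norm: every downward directed set (i.e. decreasing net)
 with infimum 0 converges to 0 in norm.\<close>
definition order_continuous_norm :: "'a::banach_lattice itself \<Rightarrow> bool" where
  "order_continuous_norm _ \<longleftrightarrow>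
     (\<forall>D :: 'a set. D \<noteq> {} \<longrightarrow>
        (\<forall>x\<in>D. \<forall>y\<in>D. \<exists>z\<in>D. z \<le> x \<and> z \<le> y) \<longrightarrow>
        (\<forall>x\<in>D. 0 \<le> x) \<longrightarrow>
        (\<forall>l. (\<forall>x\<in>D. l \<le> x) \<longrightarrow> l \<le> 0) \<longrightarrow>
        (\<forall>e>0. \<exists>x\<in>D. norm x < e))"

definition positive_op :: "('a::banach_lattice \<Rightarrow> 'b::banach_lattice) \<Rightarrow> bool" where
  "positive_op T \<longleftrightarrow> (\<forall>x. 0 \<le> x \<longrightarrow> 0 \<le> T x)"

end

theory Submission
  imports Defs "HOL-Library.Lattice_Algebras"
begin

text \<open>
  A weakly null sequence is norm bounded, so in cases (1) and (2) it suffices that it is uaw-null.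
  In case (1) this holds because \<open>0 \<le> inf (labs (x n)) u \<le> labs (x n)\<close>. In a discrete space with
  order continuous norm, \<open>u\<close> is approximated in norm by elements below finite sums of multiples
  of atoms; at an atom the truncation is controlled by its coordinate functional, so
  \<open>inf (labs (x n)) u\<close> even tends to \<open>0\<close> in norm. In case (3), \<open>T\<close> maps bounded disjoint sequences
  to norm null sequences because these are uaw-null. Since \<open>T\<close> is positive, for every \<open>e > 0\<close> there
  is \<open>u\<close> such that \<open>labs (T x) \<le> T u + w\<close> with \<open>norm w < e\<close> for all \<open>x\<close> in a given ball, and the
  truncations of the weakly null sequence \<open>T (x n)\<close> at \<open>T u\<close> tend to \<open>0\<close> in norm by the discrete
  case applied to the range.
\<close>

section \<open>The Hahn-Banach theorem and weakly null sequences\<close>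

text \<open>Homogeneity is required only as an inequality, so a functional built as an infimum needs
  just one estimate per condition; scaling by \<open>inverse t\<close> recovers equality.\<close>

definition sublinear :: "('a::real_vector \<Rightarrow> real) \<Rightarrow> bool" where
  "sublinear p \<longleftrightarrow>
     (\<forall>x y. p (x + y) \<le> p x + p y) \<and> (\<forall>t x. 0 < t \<longrightarrow> p (t *\<^sub>R x) \<le> t * p x)"

lemma sublinear_add: "sublinear p \<Longrightarrow> p (x + y) \<le> p x + p y"
  by (simp add: sublinear_def)

lemma sublinear_scaleR:
  assumes "sublinear p" "0 < t"
  shows "p (t *\<^sub>R x) = t * p x"
proof (rule antisym)
  show "p (t *\<^sub>R x) \<le> t * p x"
    using assms by (simp add: sublinear_def)
  have "p (inverse t *\<^sub>R (t *\<^sub>R x)) \<le> inverse t * p (t *\<^sub>R x)"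
    using assms unfolding sublinear_def by (metis inverse_positive_iff_positive)
  then show "t * p x \<le> p (t *\<^sub>R x)"
    using assms(2) by (simp add: field_simps)
qed

lemma sublinear_0:
  assumes "sublinear p"
  shows "p 0 = 0"
  using sublinear_scaleR[OF assms, of 2 0] by simp

lemma sublinear_scaleR':
  assumes "sublinear p" "0 \<le> t"
  shows "p (t *\<^sub>R x) = t * p x"
  using assms sublinear_scaleR[of p t x] sublinear_0[of p] by (cases "t = 0") auto

text \<open>Serves every later construction in which a functional is an infimum over a set
  \<open>S x\<close> of admissible values. The infimum is finite because an element of
  \<open>S x\<close> plus a fixed element of \<open>S (- x)\<close> dominates an element of
  \<open>S 0\<close>, which is nonnegative.\<close>

lemma sublinear_Inf:
  fixes S :: "'a::real_vector \<Rightarrow> real set"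
  assumes ne: "\<And>x. S x \<noteq> {}"
    and zero: "\<And>a. a \<in> S 0 \<Longrightarrow> 0 \<le> a"
    and add: "\<And>x y a b. a \<in> S x \<Longrightarrow> b \<in> S y \<Longrightarrow> \<exists>c\<in>S (x + y). c \<le> a + b"
    and scale: "\<And>t x a. 0 < t \<Longrightarrow> a \<in> S x \<Longrightarrow> \<exists>c\<in>S (t *\<^sub>R x). c \<le> t * a"
  shows "bdd_below (S x)" "sublinear (\<lambda>x. Inf (S x))"
proof -
  show bdd: "bdd_below (S x)" for x
  proof -
    obtain b where b: "b \<in> S (- x)" using ne by blast
    show ?thesis
    proof (rule bdd_belowI)
      fix a assume "a \<in> S x"
      then obtain c where "c \<in> S 0" "c \<le> a + b"
        using add[OF _ b, of a x] by auto
      then show "- b \<le> a" using zero[of c] by linarith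
    qed
  qed
  show "sublinear (\<lambda>x. Inf (S x))"
    unfolding sublinear_def
  proof (intro conjI allI impI)
    fix x y
    have *: "Inf (S (x + y)) \<le> a + b" if "a \<in> S x" "b \<in> S y" for a b
      using add[OF that] bdd by (meson cInf_lower order_trans)
    have "Inf (S (x + y)) - b \<le> Inf (S x)" if "b \<in> S y" for b
      using *[OF _ that] by (intro cInf_greatest[OF ne]) (simp add: algebra_simps)
    then have "Inf (S (x + y)) - Inf (S x) \<le> Inf (S y)"
      by (intro cInf_greatest[OF ne]) (simp add: algebra_simps)
    then show "Inf (S (x + y)) \<le> Inf (S x) + Inf (S y)" by simp
  next
    fix t :: real and x
    assume t: "0 < t"
    have "Inf (S (t *\<^sub>R x)) \<le> t * a" if "a \<in> S x" for a
      using scale[OF t that] bdd by (meson cInf_lower order_trans)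
    then have "Inf (S (t *\<^sub>R x)) / t \<le> Inf (S x)"
      using t by (intro cInf_greatest[OF ne]) (simp add: field_simps)
    then show "Inf (S (t *\<^sub>R x)) \<le> t * Inf (S x)"
      using t by (simp add: field_simps)
  qed
qed

text \<open>Pushing a sublinear functional down in the direction \<open>y\<close>: a minimal sublinear
  functional is unchanged by this, which forces it to be additive.\<close>

lemma sublinear_push_down:
  fixes q :: "'a::real_vector \<Rightarrow> real"
  assumes q: "sublinear q"
  obtains r where "sublinear r" "\<And>x. r x \<le> q x" "\<And>x. r x \<le> q (x + y) - q y"
proof -
  \<comment> \<open>The value with \<open>t = 0\<close> yields \<open>r x \<le> q x\<close>, the one
    with \<open>t = 1\<close> the bound \<open>q (x + y) - q y\<close>. At \<open>x = 0\<close>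
    homogeneity makes every value \<open>0\<close>.\<close>
  define S where "S = (\<lambda>x. {q (x + t *\<^sub>R y) - t * q y | t. 0 \<le> t})"
  have SI: "q (x + t *\<^sub>R y) - t * q y \<in> S x" if "0 \<le> t" for x t
    using that by (auto simp: S_def)
  have ne: "S x \<noteq> {}" for x using SI[of 0] by blast
  have zero: "0 \<le> a" if "a \<in> S 0" for a
    using that sublinear_scaleR'[OF q] by (auto simp: S_def)
  have add: "\<exists>c\<in>S (x + x'). c \<le> a + b" if a: "a \<in> S x" and b: "b \<in> S x'" for x x' a b
  proof -
    obtain s t where s: "0 \<le> s" "a = q (x + s *\<^sub>R y) - s * q y"
      and t: "0 \<le> t" "b = q (x' + t *\<^sub>R y) - t * q y"
      using a b by (auto simp: S_def)
    have "q ((x + x') + (s + t) *\<^sub>R y) \<le> q (x + s *\<^sub>R y) + q (x' + t *\<^sub>R y)"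
      using sublinear_add[OF q, of "x + s *\<^sub>R y" "x' + t *\<^sub>R y"] by (simp add: algebra_simps)
    with s t show ?thesis
      by (intro bexI[OF _ SI[of "s + t"]]) (auto simp: algebra_simps)
  qed
  have scale: "\<exists>c\<in>S (t *\<^sub>R x). c \<le> t * a" if t: "0 < t" and a: "a \<in> S x" for t x a
  proof -
    obtain s where s: "0 \<le> s" "a = q (x + s *\<^sub>R y) - s * q y"
      using a by (auto simp: S_def)
    have "q (t *\<^sub>R x + (t * s) *\<^sub>R y) = t * q (x + s *\<^sub>R y)"
      using sublinear_scaleR[OF q t, of "x + s *\<^sub>R y"] by (simp add: algebra_simps)
    with s t show ?thesis
      by (intro bexI[OF _ SI[of "t * s"]]) (auto simp: right_diff_distrib)
  qed
  note * = sublinear_Inf[of S, OF ne zero add scale]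
  show thesis
  proof (rule that)
    show "sublinear (\<lambda>x. Inf (S x))" by (rule *(2))
    show "Inf (S x) \<le> q x" for x
      using cInf_lower[OF SI[of 0 x] *(1)] by simp
    show "Inf (S x) \<le> q (x + y) - q y" for x
      using cInf_lower[OF SI[of 1 x] *(1)] by simp
  qed
qed

text \<open>Zorn's lemma applies because the pointwise infimum of a nonempty chain of sublinear
  functionals below \<open>p\<close> is again one.\<close>

lemma sublinear_minimal:
  fixes p :: "'a::real_vector \<Rightarrow> real"
  assumes p: "sublinear p"
  obtains m where "sublinear m" "\<And>x. m x \<le> p x"
    "\<And>q x. sublinear q \<Longrightarrow> (\<And>x. q x \<le> m x) \<Longrightarrow> q x = m x"
proof -
  define A where "A = {q. sublinear q \<and> (\<forall>x. q x \<le> p x)}"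
  \<comment> \<open>The order is reversed, so that a maximal element in Zorn's lemma is a minimal
    functional.\<close>
  define P where "P = (\<lambda>q r :: 'a \<Rightarrow> real. \<forall>x. r x \<le> q x)"
  have po: "partial_order_on A (relation_of P A)"
    by (rule partial_order_on_relation_ofI) (auto simp: P_def fun_eq_iff intro: order_trans antisym)
  have ch: "\<exists>u\<in>A. \<forall>q\<in>C. P q u" if C: "C \<in> Chains (relation_of P A)" for C
  proof (cases "C = {}")
    case True
    then show ?thesis using p by (auto simp: A_def)
  next
    case False
    have CA: "C \<subseteq> A" using C by (auto simp: Chains_def relation_of_def)
    have tot: "P q r \<or> P r q" if "q \<in> C" "r \<in> C" for q r
      using C that by (auto simp: Chains_def relation_of_def)
    define S where "S = (\<lambda>x. (\<lambda>q. q x) ` C)"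
    have sub: "sublinear q" if "q \<in> C" for q using CA that by (auto simp: A_def)
    have ne: "S x \<noteq> {}" for x using False by (auto simp: S_def)
    have zero: "0 \<le> a" if a: "a \<in> S 0" for a
    proof -
      obtain q where q: "q \<in> C" "a = q 0" using a by (auto simp: S_def)
      then show ?thesis using sublinear_0[OF sub[OF q(1)]] by simp
    qed
    have add: "\<exists>c\<in>S (x + x'). c \<le> a + b" if a: "a \<in> S x" and b: "b \<in> S x'" for x x' a b
    proof -
      obtain q r where q: "q \<in> C" "a = q x" and r: "r \<in> C" "b = r x'"
        using a b by (auto simp: S_def)
      \<comment> \<open>With \<open>m\<close> the smaller of \<open>q\<close> and \<open>r\<close>,
        one chain element bounds both summands.\<close>
      obtain m where m: "m \<in> C" "m x \<le> q x" "m x' \<le> r x'"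
        using tot[OF q(1) r(1)] q r unfolding P_def by (metis order_refl)
      have "m (x + x') \<le> a + b"
        using sublinear_add[OF sub[OF m(1)], of x x'] m q r by linarith
      then show ?thesis using m by (auto simp: S_def)
    qed
    have scale: "\<exists>c\<in>S (t *\<^sub>R x). c \<le> t * a" if t: "0 < t" and a: "a \<in> S x" for t x a
    proof -
      obtain q where q: "q \<in> C" "a = q x" using a by (auto simp: S_def)
      then have "q (t *\<^sub>R x) \<le> t * a" using sublinear_scaleR[OF sub t] by simp
      then show ?thesis using q(1) by (auto simp: S_def)
    qed
    note * = sublinear_Inf[of S, OF ne zero add scale]
    have low: "Inf (S x) \<le> q x" if "q \<in> C" for q x
      using that by (intro cInf_lower[OF _ *(1)]) (auto simp: S_def)
    obtain q where "q \<in> C" using False by blast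
    then have "\<forall>x. Inf (S x) \<le> p x"
      using low CA unfolding A_def by (blast intro: order_trans)
    then show ?thesis
      using *(2) low by (intro bexI[of _ "\<lambda>x. Inf (S x)"]) (auto simp: A_def P_def)
  qed
  obtain m where m: "m \<in> A" "\<forall>q\<in>A. P m q \<longrightarrow> q = m"
    using predicate_Zorn[OF po ch] by blast
  show thesis
  proof (rule that)
    show "sublinear m" "\<And>x. m x \<le> p x" using m(1) by (auto simp: A_def)
    fix q x assume q: "sublinear q" "\<And>x. q x \<le> m x"
    have "q z \<le> p z" for z
      using m(1) order_trans[OF q(2)[of z]] unfolding A_def by simp
    then have "q \<in> A" using q(1) by (simp add: A_def)
    moreover have "P m q" using q(2) by (simp add: P_def)
    ultimately have "q = m" using m(2) by blast
    then show "q x = m x" by simp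
  qed
qed

theorem hahn_banach_sublinear:
  fixes p :: "'a::real_vector \<Rightarrow> real"
  assumes p: "sublinear p"
  obtains f where "linear f" "\<And>x. f x \<le> p x" "f y = p y"
proof -
  \<comment> \<open>At \<open>- y\<close> the last bound reads \<open>r (- y) \<le> - p y\<close>,
    so every linear functional below \<open>r\<close> takes the value \<open>p y\<close> at
    \<open>y\<close>.\<close>
  obtain r where r: "sublinear r" "\<And>x. r x \<le> p x" "\<And>x. r x \<le> p (x + y) - p y"
    using sublinear_push_down[OF p, of y] by blast
  obtain m where m: "sublinear m" "\<And>x. m x \<le> r x"
    and min: "\<And>q x. sublinear q \<Longrightarrow> (\<And>x. q x \<le> m x) \<Longrightarrow> q x = m x"
    using sublinear_minimal[OF r(1)] by blast
  have add: "m (x + z) = m x + m z" for x z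
  proof (rule antisym)
    show "m (x + z) \<le> m x + m z" by (rule sublinear_add[OF m(1)])
    \<comment> \<open>By minimality \<open>q\<close> equals \<open>m\<close>, so the last bound
      becomes superadditivity of \<open>m\<close>.\<close>
    obtain q where q: "sublinear q" "\<And>x. q x \<le> m x" "\<And>x. q x \<le> m (x + z) - m z"
      using sublinear_push_down[OF m(1), of z] by blast
    show "m x + m z \<le> m (x + z)"
      using min[OF q(1,2), of x] q(3)[of x] by simp
  qed
  have minus: "m (- x) = - m x" for x
    using add[of x "- x"] sublinear_0[OF m(1)] by simp
  have "linear m"
  proof (rule linearI)
    show "m (x + z) = m x + m z" for x z by (rule add)
    show "m (t *\<^sub>R x) = t *\<^sub>R m x" for t x
    proof (cases "0 \<le> t")
      case True
      then show ?thesis by (simp add: sublinear_scaleR'[OF m(1)])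
    next
      case False
      then show ?thesis
        using sublinear_scaleR'[OF m(1), of "- t" x] minus[of "(- t) *\<^sub>R x"] by simp
    qed
  qed
  moreover have "m x \<le> p x" for x using m(2) r(2) order_trans by blast
  moreover have "p y \<le> m y"
    using m(2)[of "- y"] r(3)[of "- y"] minus[of y] sublinear_0[OF p] by simp
  ultimately show thesis by (intro that[of m]) (auto intro: antisym)
qed

section \<open>Norming functionals and uniform boundedness\<close>

lemma linear_le_norm_imp_bounded_linear:
  fixes f :: "'a::real_normed_vector \<Rightarrow> real"
  assumes "linear f" "\<And>x. f x \<le> K * norm x"
  shows "bounded_linear f" "\<bar>f x\<bar> \<le> K * norm x"
proof -
  show *: "\<bar>f x\<bar> \<le> K * norm x" for x
    using assms(2)[of x] assms(2)[of "- x"] linear_neg[OF assms(1), of x] by (simp add: abs_le_iff)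
  show "bounded_linear f"
    using assms(1) * by (intro linear_conv_bounded_linear[THEN iffD1] bounded_linear_intro[of f K])
      (auto simp: linear_add linear_scale mult.commute)
qed

lemma norming_functional:
  fixes x :: "'a::real_normed_vector"
  obtains f :: "'a \<Rightarrow>\<^sub>L real" where "norm f \<le> 1" "f x = norm x"
proof -
  have "sublinear (norm :: 'a \<Rightarrow> real)"
    by (auto simp: sublinear_def norm_triangle_ineq)
  then obtain g :: "'a \<Rightarrow> real" where g: "linear g" "\<And>z. g z \<le> norm z" "g x = norm x"
    using hahn_banach_sublinear[of norm x] by blast
  have b: "bounded_linear g" "\<And>z. \<bar>g z\<bar> \<le> 1 * norm z"
    using linear_le_norm_imp_bounded_linear[OF g(1), of 1] g(2) by auto
  show thesis
  proof (rule that)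
    show "norm (Blinfun g) \<le> 1"
      using b by (intro norm_blinfun_bound) (auto simp: bounded_linear_Blinfun_apply)
    show "blinfun_apply (Blinfun g) x = norm x"
      using b g by (simp add: bounded_linear_Blinfun_apply)
  qed
qed

text \<open>Uniform boundedness principle: the \<open>xs n\<close> act on the dual space, which is
  complete, and are pointwise bounded there. By Baire, some ball of functionals is uniformly bounded
  on the whole sequence.\<close>

theorem weakly_null_imp_bounded:
  fixes xs :: "nat \<Rightarrow> 'a::real_normed_vector"
  assumes "weakly_to xs 0"
  shows "bounded (range xs)"
proof -
  define A where "A k = (\<Inter>n. {f :: 'a \<Rightarrow>\<^sub>L real. \<bar>f (xs n)\<bar> \<le> real k})" for k
  have cl: "closed (A k)" for k
    unfolding A_def by (intro closed_INT ballI closed_Collect_le continuous_intros)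
  have cover: "(\<Union>k. A k) = UNIV"
  proof (intro equalityI subsetI UNIV_I)
    fix f :: "'a \<Rightarrow>\<^sub>L real"
    have "(\<lambda>n. f (xs n)) \<longlonglongrightarrow> f 0"
      using assms blinfun.bounded_linear_right unfolding weakly_to_def by blast
    then have "Bseq (\<lambda>n. f (xs n))" by (intro convergent_imp_Bseq) (auto simp: convergent_def)
    then obtain K where K: "\<And>n. \<bar>f (xs n)\<bar> \<le> K" unfolding Bseq_def by auto
    have "f \<in> A (nat \<lceil>K\<rceil>)"
      unfolding A_def using K order_trans real_nat_ceiling_ge by blast
    then show "f \<in> (\<Union>k. A k)" by blast
  qed
  have "\<exists>k. interior (A k) \<noteq> {}"
  proof (rule ccontr)
    assume "\<not> ?thesis"
    then have "euclidean interior_of \<Union>(range A) = {}"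
      using cl by (intro Baire_category_alt)
        (auto simp: completely_metrizable_space_euclidean)
    with cover show False by simp
  qed
  then obtain k f0 where "f0 \<in> interior (A k)" by blast
  then obtain r where r: "0 < r" "cball f0 r \<subseteq> A k"
    by (meson mem_interior_cball)
  have "norm (xs n) \<le> 2 * real k / r" for n
  proof -
    obtain g :: "'a \<Rightarrow>\<^sub>L real" where g: "norm g \<le> 1" "g (xs n) = norm (xs n)"
      using norming_functional by blast
    \<comment> \<open>Both the centre and its shift by \<open>r *\<^sub>R g\<close> lie in the ball;
      their values at \<open>xs n\<close> differ by \<open>r * norm (xs n)\<close>.\<close>
    have "f0 + r *\<^sub>R g \<in> cball f0 r" "f0 \<in> cball f0 r"
      using g(1) r(1) by (auto simp: dist_norm mult_left_le)
    then have "\<bar>blinfun_apply (f0 + r *\<^sub>R g) (xs n)\<bar> \<le> real k" "\<bar>blinfun_apply f0 (xs n)\<bar> \<le> real k"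
      using r(2) unfolding A_def by blast+
    then have "r * norm (xs n) \<le> 2 * real k"
      by (simp add: blinfun.add_left blinfun.scaleR_left g(2))
    then show ?thesis using r(1) by (simp add: field_simps)
  qed
  then show ?thesis by (auto simp: bounded_iff)
qed

section \<open>Banach lattices and positive functionals\<close>

text \<open>Makes the laws of lattice-ordered groups and the positive part \<open>pprt\<close>
  available.\<close>

instance banach_lattice \<subseteq> lattice_ab_group_add ..

lemma labs_ge: "x \<le> labs x" "- x \<le> labs x"
  by (simp_all add: labs_def)

lemma labs_leI: "x \<le> y \<Longrightarrow> - x \<le> y \<Longrightarrow> labs x \<le> y"
  by (simp add: labs_def)

lemma labs_nonneg [simp]: "0 \<le> labs x"
proof -
  have "0 \<le> labs x + labs x"
    using add_mono[OF labs_ge[of x]] by simp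
  then show ?thesis by simp
qed

lemma labs_of_nonneg: "0 \<le> x \<Longrightarrow> labs x = x"
  by (simp add: labs_def sup_absorb1 minus_le_self_iff)

lemma norm_le_norm_of_labs_le:
  fixes x y :: "'a::banach_lattice"
  assumes "labs x \<le> y"
  shows "norm x \<le> norm y"
proof (rule lattice_norm)
  have "0 \<le> y" using labs_nonneg assms by (rule order_trans)
  then show "sup x (- x) \<le> sup y (- y)"
    using assms by (simp add: labs_of_nonneg flip: labs_def)
qed

lemma norm_mono_nonneg:
  fixes x y :: "'a::banach_lattice"
  shows "0 \<le> x \<Longrightarrow> x \<le> y \<Longrightarrow> norm x \<le> norm y"
  by (rule norm_le_norm_of_labs_le) (simp add: labs_of_nonneg)

lemma norm_labs [simp]: "norm (labs x) = norm x"
  by (rule antisym; rule lattice_norm) (simp_all add: labs_of_nonneg flip: labs_def)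

section \<open>Truncation and disjointness in vector lattices\<close>

lemma inf_add_le:
  fixes x y z :: "'a::lattice_ab_group_add"
  assumes "0 \<le> x" "0 \<le> y" "0 \<le> z"
  shows "inf x (y + z) \<le> inf x y + inf x z"
proof -
  \<comment> \<open>The sum \<open>inf x y + inf x z\<close> is the infimum of \<open>x + x\<close>,
    \<open>x + z\<close>, \<open>y + x\<close> and \<open>y + z\<close>; positivity puts
    \<open>x\<close> below the first three.\<close>
  have "x \<le> x + x" "x \<le> x + z" "x \<le> y + x"
    using assms by simp_all
  then have "inf x (y + z) \<le> inf (inf (x + x) (x + z)) (inf (y + x) (y + z))"
    by (meson inf.bounded_iff inf_le1 inf_le2 order_trans)
  then show ?thesis
    by (simp add: add_inf_distrib_left add_inf_distrib_right inf_aci)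
qed

lemma inf_add_le':
  fixes x y z :: "'a::lattice_ab_group_add"
  shows "0 \<le> x \<Longrightarrow> 0 \<le> y \<Longrightarrow> 0 \<le> z \<Longrightarrow> inf (x + y) z \<le> inf x z + inf y z"
  using inf_add_le[of z x y] by (simp add: inf_commute)

lemma disjoint_add:
  fixes x y z :: "'a::lattice_ab_group_add"
  assumes "0 \<le> x" "0 \<le> y" "0 \<le> z" "inf x z = 0" "inf y z = 0"
  shows "inf (x + y) z = 0"
  using inf_add_le'[OF assms(1-3)] assms by (intro antisym) (auto intro: add_nonneg_nonneg)

lemma disjoint_mono:
  fixes x y x' y' :: "'a::lattice_ab_group_add"
  assumes "inf x' y' = 0" "0 \<le> x" "x \<le> x'" "0 \<le> y" "y \<le> y'"
  shows "inf x y = 0"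
  using inf_mono[OF assms(3,5)] assms by (intro antisym) auto

lemma scaleR_inf:
  fixes x y :: "'a::banach_lattice"
  assumes "0 < t"
  shows "inf (t *\<^sub>R x) (t *\<^sub>R y) = t *\<^sub>R inf x y"
proof (rule antisym)
  have "inf (t *\<^sub>R x) (t *\<^sub>R y) /\<^sub>R t \<le> (t *\<^sub>R x) /\<^sub>R t"
    "inf (t *\<^sub>R x) (t *\<^sub>R y) /\<^sub>R t \<le> (t *\<^sub>R y) /\<^sub>R t"
    using assms by (intro scaleR_left_mono; simp)+
  then have "inf (t *\<^sub>R x) (t *\<^sub>R y) /\<^sub>R t \<le> inf x y"
    using assms by simp
  then show "inf (t *\<^sub>R x) (t *\<^sub>R y) \<le> t *\<^sub>R inf x y"
    using pos_divideR_le_eq[OF assms] by blast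
  show "t *\<^sub>R inf x y \<le> inf (t *\<^sub>R x) (t *\<^sub>R y)"
    using assms by (auto intro!: scaleR_left_mono le_infI)
qed

lemma disjoint_scaleR:
  fixes x y :: "'a::banach_lattice"
  assumes "inf x y = 0" "0 \<le> t"
  shows "inf (t *\<^sub>R x) y = 0"
proof -
  have nn: "0 \<le> x" "0 \<le> y" using assms(1) by (metis inf_le1, metis inf_le2)
  \<comment> \<open>Scaling both sides by the same \<open>T\<close> preserves disjointness; as
    \<open>T\<close> is at least \<open>t\<close> and \<open>1\<close>, both
    \<open>t *\<^sub>R x\<close> and \<open>y\<close> lie below the scaled elements.\<close>
  define T where "T = max 1 t"
  have "inf (T *\<^sub>R x) (T *\<^sub>R y) = 0"
    using assms(1) by (subst scaleR_inf) (auto simp: T_def)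
  then show ?thesis
    using nn assms(2) scaleR_right_mono[of t T x] scaleR_right_mono[of 1 T y]
    by (elim disjoint_mono) (auto simp: T_def scaleR_nonneg_nonneg)
qed

text \<open>Writing \<open>pprt x\<close> as \<open>x + pprt (- x)\<close> and translating by
  \<open>pprt (- x)\<close> turns the infimum into \<open>inf x 0 + pprt (- x)\<close>, which
  vanishes.\<close>

lemma pprt_disjoint: "inf (pprt x) (pprt (- x)) = (0::'a::lattice_ab_group_add)"
proof -
  have "inf (pprt x) (pprt (- x)) = inf (x + pprt (- x)) (0 + pprt (- x))"
    using prts[of x] by (metis add_0 add_diff_cancel_right' diff_conv_add_uminus pprt_neg)
  also have "\<dots> = nprt x + pprt (- x)"
    by (simp add: nprt_def add_inf_distrib_right)
  finally show ?thesis by (simp add: pprt_neg)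
qed

lemma le_pprt: "x \<le> pprt (x::'a::lattice_ab_group_add)"
  by (simp add: pprt_def)

lemma pprt_le_pprt_scaleR:
  fixes x :: "'a::banach_lattice"
  assumes "1 \<le> t"
  shows "pprt x \<le> pprt (t *\<^sub>R x)"
proof -
  have "inverse t *\<^sub>R (t *\<^sub>R x) \<le> inverse t *\<^sub>R pprt (t *\<^sub>R x)"
    using assms by (intro scaleR_left_mono le_pprt) auto
  also have "\<dots> \<le> 1 *\<^sub>R pprt (t *\<^sub>R x)"
    using assms by (intro scaleR_right_mono) (auto simp: inverse_le_1_iff)
  finally have "x \<le> pprt (t *\<^sub>R x)" using assms by simp
  then show ?thesis by (simp add: pprt_def)
qed

text \<open>Whenever \<open>xs n\<close> is positive, \<open>pprt (- x)\<close> lies below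
  \<open>labs (x - xs n)\<close>, whose norm tends to \<open>0\<close>.\<close>

lemma nonneg_LIMSEQ:
  fixes x :: "'a::banach_lattice"
  assumes lim: "xs \<longlonglongrightarrow> x" and ev: "eventually (\<lambda>n. 0 \<le> xs n) sequentially"
  shows "0 \<le> x"
proof -
  have "norm (pprt (- x)) \<le> norm (x - xs n)" if "0 \<le> xs n" for n
  proof -
    have "- x \<le> - (x - xs n)" using that by simp
    also have "\<dots> \<le> labs (x - xs n)" by (rule labs_ge)
    finally have "pprt (- x) \<le> labs (x - xs n)" by (simp add: pprt_def)
    then show ?thesis using norm_mono_nonneg[of "pprt (- x)"] by fastforce
  qed
  then have "eventually (\<lambda>n. norm (pprt (- x)) \<le> norm (x - xs n)) sequentially"
    using ev by (auto elim: eventually_mono)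
  moreover have "(\<lambda>n. norm (x - xs n)) \<longlonglongrightarrow> norm (x - x)"
    by (intro tendsto_norm tendsto_diff tendsto_const lim)
  ultimately have "norm (pprt (- x)) \<le> 0"
    by (intro tendsto_lowerbound[of "\<lambda>n. norm (x - xs n)" _ sequentially]) auto
  then have "pprt (- x) = 0" by simp
  then show ?thesis using le_pprt[of "- x"] by simp
qed

lemma suminf_ge_term:
  fixes f :: "nat \<Rightarrow> 'a::banach_lattice"
  assumes sm: "summable f" and nn: "\<And>n. 0 \<le> f n"
  shows "f m \<le> suminf f"
proof -
  have "(\<lambda>n. sum f {..<n} - f m) \<longlonglongrightarrow> suminf f - f m"
    by (intro tendsto_diff summable_LIMSEQ sm tendsto_const)
  moreover have "eventually (\<lambda>n. 0 \<le> sum f {..<n} - f m) sequentially"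
    using eventually_gt_at_top[of m]
  proof eventually_elim
    case (elim n)
    then show ?case using nn by (simp add: sum.remove[of _ m] sum_nonneg)
  qed
  ultimately show ?thesis using nonneg_LIMSEQ by fastforce
qed

text \<open>The sublinear functional is the inf-convolution of \<open>K * norm\<close> with the functional that is
  \<open>- f\<close> on the negative cone, so a linear functional below it dominates both \<open>0\<close> and \<open>f\<close>
  on the positive cone.\<close>

lemma positive_dominating_functional:
  fixes f :: "'a::banach_lattice \<Rightarrow> real"
  assumes f: "bounded_linear f"
  obtains g where "bounded_linear g" "\<And>x. 0 \<le> x \<Longrightarrow> 0 \<le> g x" "\<And>x. 0 \<le> x \<Longrightarrow> f x \<le> g x"
proof -
  interpret f: bounded_linear f by (rule f)
  define K where "K = onorm f"
  have K: "f x \<le> K * norm x" for x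
    using onorm[OF f, of x] by (simp add: K_def)
  have K0: "0 \<le> K" by (simp add: K_def onorm_pos_le[OF f])
  define S where "S = (\<lambda>x. {K * norm z - f w | z w. 0 \<le> w \<and> x \<le> z - w})"
  have SI: "K * norm z - f w \<in> S x" if "0 \<le> w" "x \<le> z - w" for x z w
    using that by (auto simp: S_def)
  have ne: "S x \<noteq> {}" for x using SI[of 0 x x] by auto
  have zero: "0 \<le> a" if a: "a \<in> S 0" for a
  proof -
    obtain z w where zw: "0 \<le> w" "w \<le> z" "a = K * norm z - f w" using a by (auto simp: S_def)
    have "K * norm w \<le> K * norm z"
      using norm_mono_nonneg[OF zw(1,2)] K0 by (rule mult_left_mono)
    then show ?thesis using K[of w] zw(3) by simp
  qed
  have add: "\<exists>c\<in>S (x + y). c \<le> a + b" if a: "a \<in> S x" and b: "b \<in> S y" for x y a b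
  proof -
    obtain z w z' w' where zw: "0 \<le> w" "x \<le> z - w" "a = K * norm z - f w"
      "0 \<le> w'" "y \<le> z' - w'" "b = K * norm z' - f w'"
      using a b by (auto simp: S_def)
    have "K * norm (z + z') \<le> K * norm z + K * norm z'"
      using mult_left_mono[OF norm_triangle_ineq[of z z'] K0] by (simp add: algebra_simps)
    moreover have "x + y \<le> (z + z') - (w + w')"
      using add_mono[OF zw(2,5)] by (simp add: algebra_simps)
    ultimately show ?thesis
      using zw by (intro bexI[OF _ SI[of "w + w'"]]) (auto simp: f.add)
  qed
  have scale: "\<exists>c\<in>S (t *\<^sub>R x). c \<le> t * a" if t: "0 < t" and a: "a \<in> S x" for t x a
  proof -
    obtain z w where zw: "0 \<le> w" "x \<le> z - w" "a = K * norm z - f w" using a by (auto simp: S_def)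
    have "t *\<^sub>R x \<le> t *\<^sub>R z - t *\<^sub>R w"
      using scaleR_left_mono[OF zw(2), of t] t by (simp add: scaleR_diff_right)
    then show ?thesis
      using zw t by (intro bexI[OF _ SI[of "t *\<^sub>R w" _ "t *\<^sub>R z"]])
        (auto simp: f.scaleR right_diff_distrib scaleR_nonneg_nonneg)
  qed
  note * = sublinear_Inf[of S, OF ne zero add scale]
  obtain g where g: "linear g" "\<And>x. g x \<le> Inf (S x)"
    using hahn_banach_sublinear[OF *(2)] by blast
  have le: "g x \<le> a" if "a \<in> S x" for x a
    using cInf_lower[OF that *(1)] g(2)[of x] by linarith
  have neg: "g (- x) = - g x" for x by (rule linear_neg[OF g(1)])
  \<comment> \<open>The three claims use the pairs \<open>z = x, w = 0\<close> for the norm bound,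
    \<open>z = w = 0\<close> for positivity and \<open>z = 0, w = x\<close> for domination of
    \<open>f\<close>, the last two at the point \<open>- x\<close>.\<close>
  show thesis
  proof (rule that)
    show "bounded_linear g"
    proof (rule linear_le_norm_imp_bounded_linear(1)[OF g(1)])
      show "g x \<le> K * norm x" for x
        using le[OF SI[of 0 x x]] f.zero by simp
    qed
    show "0 \<le> g x" if "0 \<le> x" for x
      using le[OF SI[of 0 "- x" 0]] that f.zero by (simp add: neg)
    show "f x \<le> g x" if "0 \<le> x" for x
      using le[OF SI[of x "- x" 0]] that by (simp add: neg)
  qed
qed

text \<open>Every bounded functional \<open>f\<close> is \<open>g - (g - f)\<close> with
  \<open>g\<close> and \<open>g - f\<close> positive, so positive functionals suffice as
  tests.\<close>

lemma weakly_to_0_positiveI: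
  fixes xs :: "nat \<Rightarrow> 'a::banach_lattice"
  assumes "\<And>f. bounded_linear f \<Longrightarrow> (\<And>x. 0 \<le> x \<Longrightarrow> 0 \<le> f x) \<Longrightarrow> (\<lambda>n. f (xs n)) \<longlonglongrightarrow> (0::real)"
  shows "weakly_to xs 0"
  unfolding weakly_to_def
proof (intro allI impI)
  fix f :: "'a \<Rightarrow> real" assume f: "bounded_linear f"
  obtain g where g: "bounded_linear g" "\<And>x. 0 \<le> x \<Longrightarrow> 0 \<le> g x" "\<And>x. 0 \<le> x \<Longrightarrow> f x \<le> g x"
    using positive_dominating_functional[OF f] by blast
  have "(\<lambda>n. g (xs n)) \<longlonglongrightarrow> 0" by (rule assms[OF g(1,2)])
  moreover have "(\<lambda>n. g (xs n) - f (xs n)) \<longlonglongrightarrow> 0"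
    by (rule assms[OF bounded_linear_sub[OF g(1) f]]) (simp add: g(3))
  ultimately have "(\<lambda>n. g (xs n) - (g (xs n) - f (xs n))) \<longlonglongrightarrow> 0 - 0"
    by (rule tendsto_diff)
  then show "(\<lambda>n. f (xs n)) \<longlonglongrightarrow> f 0"
    using bounded_linear.linear[OF f] by (simp add: linear_0)
qed

lemma weakly_to_0_of_norm:
  fixes xs :: "nat \<Rightarrow> 'a::real_normed_vector"
  assumes "(\<lambda>n. norm (xs n)) \<longlonglongrightarrow> 0"
  shows "weakly_to xs 0"
  unfolding weakly_to_def
proof (intro allI impI)
  fix f :: "'a \<Rightarrow> real" assume "bounded_linear f"
  then show "(\<lambda>n. f (xs n)) \<longlonglongrightarrow> f 0"
    by (rule bounded_linear.tendsto) (rule tendsto_norm_zero_cancel[OF assms])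
qed

lemma weakly_to_0_mono:
  fixes xs ys :: "nat \<Rightarrow> 'a::banach_lattice"
  assumes "weakly_to ys 0" "\<And>n. 0 \<le> xs n" "\<And>n. xs n \<le> ys n"
  shows "weakly_to xs 0"
proof (rule weakly_to_0_positiveI)
  fix f :: "'a \<Rightarrow> real"
  assume f: "bounded_linear f" "\<And>x. 0 \<le> x \<Longrightarrow> 0 \<le> f x"
  interpret f: bounded_linear f by (rule f(1))
  have lim: "(\<lambda>n. f (ys n)) \<longlonglongrightarrow> 0"
    using assms(1)[unfolded weakly_to_def, rule_format, OF f(1)] by (simp add: f.zero)
  show "(\<lambda>n. f (xs n)) \<longlonglongrightarrow> 0"
  proof (rule tendsto_sandwich[OF always_eventually always_eventually tendsto_const lim])
    show "\<forall>n. 0 \<le> f (xs n)" using f(2)[OF assms(2)] by blast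
    show "\<forall>n. f (xs n) \<le> f (ys n)"
      using f(2)[of "ys n - xs n" for n] assms(3) by (simp add: f.diff)
  qed
qed

text \<open>Truncations at \<open>u\<close> stay disjoint, so their partial sums are suprema and
  remain below \<open>u\<close>. For a positive \<open>f\<close> the series of the
  \<open>f (a n)\<close> is then bounded by \<open>f u\<close>, hence converges, and its terms tend
  to \<open>0\<close>.\<close>

lemma disjoint_uaw_null:
  fixes v :: "nat \<Rightarrow> 'a::banach_lattice"
  assumes nn: "\<And>n. 0 \<le> v n" and disj: "\<And>m n. n < m \<Longrightarrow> inf (v n) (v m) = 0"
  shows "uaw_to v 0"
  unfolding uaw_to_def
proof (intro allI impI)
  fix u :: 'a assume u: "0 \<le> u"
  define a where "a n = inf (v n) u" for n
  have a: "0 \<le> a n" "a n \<le> v n" "a n \<le> u" for n using nn u by (auto simp: a_def)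
  have S0: "0 \<le> (\<Sum>n<N. a n)" for N using a by (simp add: sum_nonneg)
  have dS: "N \<le> m \<Longrightarrow> inf (\<Sum>n<N. a n) (a m) = 0" for N m
  proof (induction N)
    case 0
    then show ?case using a by (simp add: inf_absorb1)
  next
    case (Suc N)
    have "inf (a N) (a m) = 0"
      by (rule disjoint_mono[OF disj[of N m]]) (use Suc.prems a in auto)
    then show ?case using disjoint_add[OF S0 a(1) a(1)] Suc by simp
  qed
  have le: "(\<Sum>n<N. a n) \<le> u" for N
  proof (induction N)
    case (Suc N)
    have "(\<Sum>n<N. a n) + a N = sup (\<Sum>n<N. a n) (a N)"
      using add_eq_inf_sup[of "\<Sum>n<N. a n" "a N"] dS[of N N] by simp
    then show ?case using Suc a by simp
  qed (simp add: u)
  have "weakly_to a 0"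
  proof (rule weakly_to_0_positiveI)
    fix f :: "'a \<Rightarrow> real"
    assume f: "bounded_linear f" "\<And>x. 0 \<le> x \<Longrightarrow> 0 \<le> f x"
    interpret f: bounded_linear f by (rule f(1))
    have "(\<Sum>n<N. f (a n)) \<le> f u" for N
      using f(2)[of "u - (\<Sum>n<N. a n)"] le[of N] by (simp add: f.diff f.sum)
    then have "summable (\<lambda>n. f (a n))"
      by (rule summableI_nonneg_bounded[OF f(2)[OF a(1)]])
    then show "(\<lambda>n. f (a n)) \<longlonglongrightarrow> 0" by (rule summable_LIMSEQ_zero)
  qed
  then show "weakly_to (\<lambda>n. inf (labs (v n - 0)) u) 0"
    using nn by (simp add: a_def[abs_def] labs_of_nonneg)
qed

section \<open>Discrete Banach lattices\<close>

lemma norm_LIMSEQ_0_comparison: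
  assumes "g \<longlonglongrightarrow> 0" "\<And>n. norm (f n) \<le> g n"
  shows "(\<lambda>n. norm (f n)) \<longlonglongrightarrow> 0"
  by (rule tendsto_sandwich[OF always_eventually always_eventually tendsto_const assms(1)])
    (use assms(2) in auto)

lemma norm_inf_add_le:
  fixes x y z :: "'a::banach_lattice"
  assumes "0 \<le> x" "0 \<le> y" "0 \<le> z"
  shows "norm (inf x (y + z)) \<le> norm (inf x y) + norm (inf x z)"
proof -
  have "norm (inf x (y + z)) \<le> norm (inf x y + inf x z)"
    using assms by (intro norm_mono_nonneg inf_add_le) (auto intro: add_nonneg_nonneg)
  also have "\<dots> \<le> norm (inf x y) + norm (inf x z)" by (rule norm_triangle_ineq)
  finally show ?thesis .
qed

text \<open>The functional is below \<open>x \<mapsto> inf {t + norm z / norm a}\<close>, the infimum over all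
  representations \<open>x \<le> t *\<^sub>R a + b + z\<close> with \<open>b\<close> positive and disjoint from \<open>a\<close>.\<close>

lemma coordinate_functional:
  fixes a :: "'a::banach_lattice"
  assumes a: "0 < a"
  obtains \<phi> :: "'a \<Rightarrow> real" where "bounded_linear \<phi>" "\<phi> a = 1"
    "\<And>x. 0 \<le> x \<Longrightarrow> 0 \<le> \<phi> x" "\<And>b. 0 \<le> b \<Longrightarrow> inf b a = 0 \<Longrightarrow> \<phi> b = 0"
proof -
  have a0: "0 \<le> a" and na: "0 < norm a" using a by auto
  define S where
    "S = (\<lambda>x. {t + norm z / norm a | t b z. 0 \<le> b \<and> inf b a = 0 \<and> x \<le> t *\<^sub>R a + b + z})"
  have SI: "t + norm z / norm a \<in> S x"
    if "0 \<le> b" "inf b a = 0" "x \<le> t *\<^sub>R a + b + z" for t b z x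
    using that by (auto simp: S_def)
  have z: "inf 0 a = 0" using a0 by (simp add: inf_absorb1)
  have ne: "S x \<noteq> {}" for x using SI[of 0 x 0 x] z by auto
  have zero: "0 \<le> r" if r: "r \<in> S 0" for r
  proof -
    obtain t b z where *: "0 \<le> b" "inf b a = 0" "0 \<le> t *\<^sub>R a + b + z" "r = t + norm z / norm a"
      using r by (auto simp: S_def)
    show ?thesis
    proof (cases "0 \<le> t")
      case True
      then show ?thesis using *(4) by simp
    next
      case False
      \<comment> \<open>For negative \<open>t\<close> the inequality becomes
        \<open>s *\<^sub>R a \<le> b + z\<close>. Truncating at \<open>s *\<^sub>R a\<close>
        eliminates the disjoint \<open>b\<close>, so \<open>labs z\<close> alone dominates
        \<open>s *\<^sub>R a\<close>; dividing by \<open>norm a\<close> is the normalisation that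
        makes this suffice.\<close>
      define s where "s = - t"
      have s: "0 < s" using False by (simp add: s_def)
      have sa: "0 \<le> s *\<^sub>R a" using s a0 by (simp add: scaleR_nonneg_nonneg)
      have "s *\<^sub>R a \<le> b + z"
        using diff_right_mono[OF *(3), of "t *\<^sub>R a"] by (simp add: s_def)
      also have "\<dots> \<le> b + labs z" by (simp add: labs_ge)
      finally have "s *\<^sub>R a \<le> inf (s *\<^sub>R a) (b + labs z)" by simp
      also have "\<dots> \<le> inf (s *\<^sub>R a) b + inf (s *\<^sub>R a) (labs z)"
        using sa *(1) by (intro inf_add_le) auto
      also have "inf (s *\<^sub>R a) b = 0"
        using *(2) s by (intro disjoint_scaleR) (auto simp: inf_commute)
      finally have "s *\<^sub>R a \<le> labs z" by simp
      then have "s * norm a \<le> norm z"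
        using norm_mono_nonneg[OF sa] s by fastforce
      then have "s \<le> norm z / norm a" using na by (simp add: pos_le_divide_eq)
      then show ?thesis using *(4) by (simp add: s_def)
    qed
  qed
  have add: "\<exists>c\<in>S (x + y). c \<le> r + r'" if r: "r \<in> S x" and r': "r' \<in> S y" for x y r r'
  proof -
    obtain t b z where *: "0 \<le> b" "inf b a = 0" "x \<le> t *\<^sub>R a + b + z" "r = t + norm z / norm a"
      using r by (auto simp: S_def)
    obtain t' b' z' where **: "0 \<le> b'" "inf b' a = 0" "y \<le> t' *\<^sub>R a + b' + z'"
        "r' = t' + norm z' / norm a"
      using r' by (auto simp: S_def)
    have "(t + t') + norm (z + z') / norm a \<in> S (x + y)"
    proof (rule SI)
      show "inf (b + b') a = 0" using * ** a0 by (intro disjoint_add)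
      show "x + y \<le> (t + t') *\<^sub>R a + (b + b') + (z + z')"
        using add_mono[OF *(3) **(3)] by (simp add: algebra_simps)
    qed (use * ** in simp)
    moreover have "norm (z + z') / norm a \<le> norm z / norm a + norm z' / norm a"
      using divide_right_mono[OF norm_triangle_ineq[of z z'], of "norm a"]
      by (simp add: add_divide_distrib)
    ultimately show ?thesis using *(4) **(4)
      by (intro bexI[of _ "(t + t') + norm (z + z') / norm a"]) simp_all
  qed
  have scale: "\<exists>c\<in>S (k *\<^sub>R x). c \<le> k * r" if k: "0 < k" and r: "r \<in> S x" for k x r
  proof -
    obtain t b z where *: "0 \<le> b" "inf b a = 0" "x \<le> t *\<^sub>R a + b + z" "r = t + norm z / norm a"
      using r by (auto simp: S_def)
    have "k * t + norm (k *\<^sub>R z) / norm a \<in> S (k *\<^sub>R x)"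
    proof (rule SI)
      show "0 \<le> k *\<^sub>R b" using * k by (simp add: scaleR_nonneg_nonneg)
      show "inf (k *\<^sub>R b) a = 0" using * k by (simp add: disjoint_scaleR)
      show "k *\<^sub>R x \<le> (k * t) *\<^sub>R a + k *\<^sub>R b + k *\<^sub>R z"
        using scaleR_left_mono[OF *(3), of k] k by (simp add: scaleR_add_right)
    qed
    moreover have "k * t + norm (k *\<^sub>R z) / norm a = k * r"
      using *(4) k by (simp add: distrib_left)
    ultimately show ?thesis by (metis order_refl)
  qed
  note * = sublinear_Inf[of S, OF ne zero add scale]
  obtain g where g: "linear g" "\<And>x. g x \<le> Inf (S x)"
    using hahn_banach_sublinear[OF *(2)] by blast
  have le: "g x \<le> r" if "r \<in> S x" for x r
    using cInf_lower[OF that *(1)] g(2)[of x] by linarith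
  have neg: "g (- x) = - g x" for x by (rule linear_neg[OF g(1)])
  have pos: "0 \<le> g x" if "0 \<le> x" for x
    using le[OF SI[of 0 "- x" 0 0]] that z by (simp add: neg)
  \<comment> \<open>The representations used are \<open>z = x\<close> for boundedness,
    \<open>t = 1\<close> and \<open>t = - 1\<close> for the value at \<open>a\<close>, and
    \<open>b\<close> itself for vanishing on elements disjoint from \<open>a\<close>.\<close>
  show thesis
  proof (rule that)
    show "bounded_linear g"
    proof (rule linear_le_norm_imp_bounded_linear(1)[OF g(1)])
      show "g x \<le> (1 / norm a) * norm x" for x
        using le[OF SI[of 0 x 0 x]] z by simp
    qed
    show "g a = 1"
      using le[OF SI[of 0 a 1 0]] le[OF SI[of 0 "- a" "- 1" 0]] z by (simp add: neg)
    show "0 \<le> g x" if "0 \<le> x" for x using that by (rule pos)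
    show "g b = 0" if "0 \<le> b" "inf b a = 0" for b
      using le[OF SI[of b b 0 0]] pos[of b] that by simp
  qed
qed

text \<open>Since \<open>a\<close> is an atom, \<open>inf (pprt x) a\<close> is some
  \<open>t *\<^sub>R a\<close>. If \<open>t\<close> is positive, \<open>pprt (- x)\<close> is
  disjoint from \<open>a\<close> and invisible to the coordinate functional \<open>\<phi>\<close>,
  whence \<open>t \<le> \<bar>\<phi> x\<bar>\<close>. The same for \<open>- x\<close> bounds the
  truncation by a multiple of \<open>\<bar>\<phi> x\<bar>\<close>.\<close>

lemma weakly_null_inf_atom:
  fixes xs :: "nat \<Rightarrow> 'a::banach_lattice"
  assumes xs: "weakly_to xs 0" and a: "atom a"
  shows "(\<lambda>n. norm (inf (labs (xs n)) a)) \<longlonglongrightarrow> 0"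
proof -
  have a0: "0 < a" using a by (simp add: atom_def)
  then obtain \<phi> :: "'a \<Rightarrow> real" where \<phi>: "bounded_linear \<phi>" "\<phi> a = 1"
    "\<And>x. 0 \<le> x \<Longrightarrow> 0 \<le> \<phi> x" "\<And>b. 0 \<le> b \<Longrightarrow> inf b a = 0 \<Longrightarrow> \<phi> b = 0"
    using coordinate_functional by blast
  interpret \<phi>: bounded_linear \<phi> by (rule \<phi>(1))
  have part: "inf (pprt x) a \<le> \<bar>\<phi> x\<bar> *\<^sub>R a" for x
  proof -
    obtain t where t: "inf (pprt x) a = t *\<^sub>R a"
      using a unfolding atom_def by (metis inf_le2 le_inf_iff less_imp_le zero_le_pprt)
    show ?thesis
    proof (cases "0 < t")
      case False
      then have "t *\<^sub>R a \<le> \<bar>\<phi> x\<bar> *\<^sub>R a" using a0 by (intro scaleR_right_mono) auto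
      then show ?thesis by (simp add: t)
    next
      case True
      have ta: "t *\<^sub>R a \<le> pprt x" "0 \<le> t *\<^sub>R a"
        using t[symmetric] a0 by auto
      have ta_disj: "inf (t *\<^sub>R a) (pprt (- x)) = 0"
        by (rule disjoint_mono[OF pprt_disjoint[of x]]) (use ta in auto)
      have "inf a (pprt (- x)) = 0"
        using disjoint_scaleR[OF ta_disj, of "inverse t"] True by simp
      then have "\<phi> (pprt (- x)) = 0"
        by (intro \<phi>(4)) (simp_all add: inf_commute)
      moreover have "\<phi> x = \<phi> (pprt x) - \<phi> (pprt (- x))"
        using arg_cong[OF prts[of x], of \<phi>] by (simp add: pprt_neg \<phi>.add \<phi>.neg)
      moreover have "\<phi> (t *\<^sub>R a) \<le> \<phi> (pprt x)"
        using \<phi>(3)[of "pprt x - t *\<^sub>R a"] ta by (simp add: \<phi>.diff)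
      ultimately have "t \<le> \<bar>\<phi> x\<bar>" by (simp add: \<phi>.scaleR \<phi>(2))
      then have "t *\<^sub>R a \<le> \<bar>\<phi> x\<bar> *\<^sub>R a" using a0 by (intro scaleR_right_mono) auto
      then show ?thesis by (simp add: t)
    qed
  qed
  have bound: "norm (inf (labs x) a) \<le> 2 * \<bar>\<phi> x\<bar> * norm a" for x
  proof -
    have "labs x \<le> pprt x + pprt (- x)"
      by (rule labs_leI) (auto intro: add_increasing add_increasing2 simp: le_pprt)
    then have "inf (labs x) a \<le> inf (pprt x + pprt (- x)) a" by (rule inf_mono) simp
    also have "\<dots> \<le> inf (pprt x) a + inf (pprt (- x)) a"
      using a0 by (intro inf_add_le') auto
    also have "\<dots> \<le> \<bar>\<phi> x\<bar> *\<^sub>R a + \<bar>\<phi> (- x)\<bar> *\<^sub>R a" by (intro add_mono part)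
    also have "\<dots> = (2 * \<bar>\<phi> x\<bar>) *\<^sub>R a" by (simp add: \<phi>.neg flip: scaleR_add_left)
    finally show ?thesis
      using norm_mono_nonneg[of "inf (labs x) a" "(2 * \<bar>\<phi> x\<bar>) *\<^sub>R a"] a0 by simp
  qed
  have "(\<lambda>n. \<phi> (xs n)) \<longlonglongrightarrow> 0"
    using xs[unfolded weakly_to_def, rule_format, OF \<phi>(1)] by (simp add: \<phi>.zero)
  then have "(\<lambda>n. 2 * \<bar>\<phi> (xs n)\<bar> * norm a) \<longlonglongrightarrow> 2 * \<bar>0\<bar> * norm a"
    by (intro tendsto_mult tendsto_const tendsto_rabs)
  then have "(\<lambda>n. 2 * \<bar>\<phi> (xs n)\<bar> * norm a) \<longlonglongrightarrow> 0" by simp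
  then show ?thesis by (rule norm_LIMSEQ_0_comparison) (rule bound)
qed

text \<open>The set \<open>P\<close> of those \<open>s\<close> for which the truncations at \<open>s\<close> tend to \<open>0\<close> contains the atoms
  and is closed under sums. If \<open>l\<close> is a lower bound of all \<open>u - s\<close> with \<open>s \<in> P\<close>, \<open>s \<le> u\<close>, and
  \<open>pprt l\<close> dominates an atom \<open>a\<close>, then \<open>n *\<^sub>R a \<le> u\<close> for all \<open>n\<close>, which is impossible.\<close>

lemma weakly_null_inf_discrete:
  fixes xs :: "nat \<Rightarrow> 'a::banach_lattice"
  assumes disc: "discrete_lattice TYPE('a)" and oc: "order_continuous_norm TYPE('a)"
    and xs: "weakly_to xs 0" and u: "0 \<le> u"
  shows "(\<lambda>n. norm (inf (labs (xs n)) u)) \<longlonglongrightarrow> 0"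
proof -
  define P where "P = {s. 0 \<le> s \<and> (\<lambda>n. norm (inf (labs (xs n)) s)) \<longlonglongrightarrow> 0}"
  have P_add: "s + t \<in> P" if "s \<in> P" "t \<in> P" for s t
  proof -
    have "(\<lambda>n. norm (inf (labs (xs n)) s) + norm (inf (labs (xs n)) t)) \<longlonglongrightarrow> 0"
      using that by (intro tendsto_add_zero) (auto simp: P_def)
    then have "(\<lambda>n. norm (inf (labs (xs n)) (s + t))) \<longlonglongrightarrow> 0"
      by (rule norm_LIMSEQ_0_comparison) (use that in \<open>simp add: P_def norm_inf_add_le\<close>)
    then show ?thesis using that by (auto simp: P_def)
  qed
  have P_mono: "s \<in> P" if "0 \<le> s" "s \<le> t" "t \<in> P" for s t
  proof -
    have "norm (inf (labs (xs n)) s) \<le> norm (inf (labs (xs n)) t)" for n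
      using that by (intro norm_mono_nonneg) (auto intro: le_infI2)
    moreover have "(\<lambda>n. norm (inf (labs (xs n)) t)) \<longlonglongrightarrow> 0"
      using that by (simp add: P_def)
    ultimately have "(\<lambda>n. norm (inf (labs (xs n)) s)) \<longlonglongrightarrow> 0"
      by (intro norm_LIMSEQ_0_comparison)
    then show ?thesis using that by (simp add: P_def)
  qed
  have P_0: "0 \<in> P" by (simp add: P_def inf_absorb2)
  have P_atom: "a \<in> P" if "atom a" for a
    using weakly_null_inf_atom[OF xs that] that by (simp add: P_def atom_def less_imp_le)
  \<comment> \<open>Order continuity applied to these remainders approximates \<open>u\<close> in
    norm from below by elements of \<open>P\<close>.\<close>
  define D where "D = (\<lambda>s. u - s) ` {s \<in> P. s \<le> u}"
  have approx: "\<forall>e>0. \<exists>x\<in>D. norm x < e"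
  proof (rule oc[unfolded order_continuous_norm_def, THEN spec, THEN mp, THEN mp, THEN mp, THEN mp])
    show "D \<noteq> {}" using P_0 u by (auto simp: D_def)
    have "\<exists>z\<in>D. z \<le> x \<and> z \<le> y" if xy: "x \<in> D" "y \<in> D" for x y
    proof -
      obtain s t where s: "s \<in> P" "s \<le> u" "x = u - s" and t: "t \<in> P" "t \<le> u" "y = u - t"
        using xy by (auto simp: D_def)
      have nn: "0 \<le> s" "0 \<le> t" using s t by (auto simp: P_def)
      \<comment> \<open>For positive elements \<open>sup s t\<close> lies below
        \<open>s + t\<close>, so \<open>P\<close> is closed under suprema and \<open>D\<close> is
        directed downward.\<close>
      have "sup s t \<in> P"
        by (rule P_mono[OF _ _ P_add[OF s(1) t(1)]]) (use nn in \<open>auto intro: le_supI1\<close>)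
      then have "u - sup s t \<in> D" using s t unfolding D_def by (intro imageI) simp
      moreover have "u - sup s t \<le> x" "u - sup s t \<le> y"
        unfolding s(3) t(3) by (intro diff_left_mono sup_ge1 sup_ge2)+
      ultimately show ?thesis by blast
    qed
    then show "\<forall>x\<in>D. \<forall>y\<in>D. \<exists>z\<in>D. z \<le> x \<and> z \<le> y" by blast
    show "\<forall>x\<in>D. 0 \<le> x" by (auto simp: D_def)
    have "l \<le> 0" if l: "\<forall>x\<in>D. l \<le> x" for l
    proof (rule ccontr)
      assume "\<not> l \<le> 0"
      then have "pprt l \<noteq> 0" using le_pprt[of l] by auto
      then have "0 < pprt l" by (simp add: order_less_le)
      then obtain a where a: "atom a" "a \<le> pprt l"
        using disc unfolding discrete_lattice_def by blast
      have step: "s + a \<le> u" if "s \<in> P" "s \<le> u" for s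
      proof -
        have "l \<le> u - s" using l that by (auto simp: D_def)
        then have "pprt l \<le> u - s" using that by (simp add: pprt_def)
        with a(2) have "a \<le> u - s" by (rule order_trans)
        then show ?thesis by (simp add: algebra_simps)
      qed
      have na: "real n *\<^sub>R a \<in> P \<and> real n *\<^sub>R a \<le> u" for n
      proof (induction n)
        case 0
        then show ?case using P_0 u by simp
      next
        case (Suc n)
        then show ?case
          using step[of "real n *\<^sub>R a"] P_add[OF _ P_atom[OF a(1)], of "real n *\<^sub>R a"]
          by (simp add: scaleR_add_left add.commute)
      qed
      have le: "real n * norm a \<le> norm u" for n
        using norm_mono_nonneg[of "real n *\<^sub>R a" u] na[of n] by (simp add: P_def)
      have "0 < norm a" using a(1) by (auto simp: atom_def)
      then obtain n where "norm u < real n * norm a" using reals_Archimedean3 by blast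
      with le[of n] show False by simp
    qed
    then show "\<forall>l. (\<forall>x\<in>D. l \<le> x) \<longrightarrow> l \<le> 0" by blast
  qed
  show ?thesis
  proof (rule LIMSEQ_I)
    fix e :: real assume e: "0 < e"
    obtain s where s: "s \<in> P" "s \<le> u" "norm (u - s) < e / 2"
      using approx[rule_format, of "e / 2"] e by (auto simp: D_def)
    have "(\<lambda>n. norm (inf (labs (xs n)) s)) \<longlonglongrightarrow> 0" using s(1) by (simp add: P_def)
    then obtain N where N: "\<And>n. n \<ge> N \<Longrightarrow> norm (inf (labs (xs n)) s) < e / 2"
      using LIMSEQ_D[of _ 0 "e / 2"] e by fastforce
    have "norm (inf (labs (xs n)) u) < e" if "n \<ge> N" for n
    proof -
      have "norm (inf (labs (xs n)) (s + (u - s)))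
          \<le> norm (inf (labs (xs n)) s) + norm (inf (labs (xs n)) (u - s))"
        using s by (intro norm_inf_add_le) (auto simp: P_def)
      moreover have "norm (inf (labs (xs n)) (u - s)) \<le> norm (u - s)"
        using s by (intro norm_mono_nonneg) auto
      ultimately show ?thesis using N[OF that] s(3) by simp
    qed
    then show "\<exists>N. \<forall>n\<ge>N. norm (norm (inf (labs (xs n)) u) - 0) < e" by auto
  qed
qed

section \<open>Positive uaw-Dunford-Pettis operators\<close>

text \<open>If no \<open>u\<close> works, choose \<open>x n\<close> recursively so that \<open>x n\<close> is bad for \<open>4 ^ n\<close> times the sum
  \<open>s n\<close> of its predecessors. Subtracting in addition a small multiple of
  \<open>y = (\<Sum>n. (1/2) ^ n *\<^sub>R x n)\<close> makes the positive parts \<open>v n\<close> pairwise disjoint, while changing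
  their images under \<open>T\<close> by a null sequence only.\<close>

lemma positive_op_almost_order_bounded:
  fixes T :: "'a::banach_lattice \<Rightarrow> 'b::banach_lattice"
  assumes T: "bounded_linear T" "positive_op T"
    and null: "\<And>v. bounded (range v) \<Longrightarrow> (\<And>n. 0 \<le> v n) \<Longrightarrow>
        (\<And>m n. n < m \<Longrightarrow> inf (v n) (v m) = 0) \<Longrightarrow> (\<lambda>n. norm (T (v n))) \<longlonglongrightarrow> 0"
    and e: "0 < e"
  obtains u where "0 \<le> u"
    "\<And>x. 0 \<le> x \<Longrightarrow> norm x \<le> M \<Longrightarrow> norm (T (pprt (x - u))) < e"
proof (rule ccontr)
  interpret T: bounded_linear T by (rule T(1))
  assume "\<not> thesis"
  \<comment> \<open>The negated thesis in usable form: a \<open>u\<close> that meets both conditions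
    would prove anything.\<close>
  note no_witness = that[THEN notE[OF this]]
  have "\<exists>x. 0 \<le> x \<and> norm x \<le> M \<and> e \<le> norm (T (pprt (x - u)))" if "0 \<le> u" for u
    using no_witness[OF that] by (meson linorder_not_le)
  then obtain g where g: "\<And>u. 0 \<le> u \<Longrightarrow> 0 \<le> g u" "\<And>u. 0 \<le> u \<Longrightarrow> norm (g u) \<le> M"
    "\<And>u. 0 \<le> u \<Longrightarrow> e \<le> norm (T (pprt (g u - u)))"
    by metis
  \<comment> \<open>Here \<open>s n\<close> is the sum of \<open>x 0\<close> up to
    \<open>x (n - 1)\<close>, and \<open>x n\<close> is the chosen counterexample for
    \<open>4 ^ n *\<^sub>R s n\<close>.\<close>
  define s where "s = rec_nat 0 (\<lambda>n s. s + g (4 ^ n *\<^sub>R s))"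
  define x where "x n = g (4 ^ n *\<^sub>R s n)" for n
  have s_0: "s 0 = 0" and s_Suc: "s (Suc n) = s n + x n" for n
    by (simp_all add: s_def x_def)
  have s_nn: "0 \<le> s n" for n
    by (induction n) (auto simp: s_0 s_Suc x_def intro!: add_nonneg_nonneg g scaleR_nonneg_nonneg)
  then have sc: "0 \<le> (4 :: real) ^ n *\<^sub>R s n" for n by (simp add: scaleR_nonneg_nonneg)
  have x: "0 \<le> x n" "norm (x n) \<le> M" "e \<le> norm (T (pprt (x n - 4 ^ n *\<^sub>R s n)))" for n
    unfolding x_def using g[OF sc] by auto
  have s_ge: "n < m \<Longrightarrow> x n \<le> s m" for n m
  proof (induction m)
    case (Suc m)
    then show ?case
      using s_nn[of m] x(1)[of m] order_trans[of "x n" "s m" "s m + x m"]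
      by (cases "n = m") (auto simp: s_Suc)
  qed simp
  have sm: "summable (\<lambda>n. (1/2) ^ n *\<^sub>R x n)"
  proof (rule summable_comparison_test')
    show "summable (\<lambda>n. (1/2) ^ n * M)" by (intro summable_mult2 summable_geometric) simp
    show "norm ((1/2) ^ n *\<^sub>R x n) \<le> (1/2) ^ n * M" if "0 \<le> n" for n
      using x(2)[of n] by (simp add: divide_right_mono)
  qed
  \<comment> \<open>The later \<open>x m\<close> are unknown when \<open>x n\<close> is chosen. As
    \<open>y\<close> dominates a multiple of each of them, subtracting a multiple of
    \<open>y\<close> accounts for all of them at once.\<close>
  define y where "y = (\<Sum>n. (1/2) ^ n *\<^sub>R x n)"
  have y_ge: "(1/2) ^ n *\<^sub>R x n \<le> y" for n
    unfolding y_def using sm by (rule suminf_ge_term) (simp add: scaleR_nonneg_nonneg x)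
  have "0 \<le> (1/2) ^ 0 *\<^sub>R x 0" using x(1) by simp
  also note y_ge[of 0]
  finally have y_nn: "0 \<le> y" .
  define v where "v n = pprt (x n - 4 ^ n *\<^sub>R s n - (1/2) ^ n *\<^sub>R y)" for n
  have v_le: "v n \<le> x n" for n
  proof -
    have "0 \<le> 4 ^ n *\<^sub>R s n + (1/2) ^ n *\<^sub>R y"
      using sc[of n] y_nn by (intro add_nonneg_nonneg) (auto simp: scaleR_nonneg_nonneg)
    then have "x n - (4 ^ n *\<^sub>R s n + (1/2) ^ n *\<^sub>R y) \<le> x n"
      by (metis diff_left_mono diff_zero)
    then show ?thesis using x(1)[of n] unfolding v_def pprt_def diff_diff_eq by (rule le_supI)
  qed
  \<comment> \<open>Both are compared with \<open>d = 4 ^ m *\<^sub>R x n - x m\<close>: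
    \<open>v n\<close> lies below a multiple of its positive part through the \<open>y\<close> term,
    and \<open>4 ^ m\<close> absorbs that multiple, while \<open>v m\<close> lies below its negative
    part because \<open>s m\<close> contains \<open>x n\<close>.\<close>
  have disj: "inf (v n) (v m) = 0" if nm: "n < m" for n m
  proof (rule disjoint_mono[OF pprt_disjoint[of "4 ^ m *\<^sub>R x n - x m"]])
    have "(1/4) ^ m *\<^sub>R x m \<le> ((1/2) ^ n * (1/2) ^ m) *\<^sub>R x m"
    proof (rule scaleR_right_mono[OF _ x(1)])
      have "(1/4 :: real) ^ m = (1/2) ^ m * (1/2) ^ m"
        by (simp flip: power_mult_distrib)
      also have "\<dots> \<le> (1/2) ^ n * (1/2) ^ m"
        using nm by (intro mult_right_mono power_decreasing) auto
      finally show "(1/4 :: real) ^ m \<le> (1/2) ^ n * (1/2) ^ m" .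
    qed
    also have "\<dots> \<le> (1/2) ^ n *\<^sub>R y"
      using scaleR_left_mono[OF y_ge[of m], of "(1/2) ^ n"] by simp
    finally have *: "(1/4) ^ m *\<^sub>R x m \<le> 4 ^ n *\<^sub>R s n + (1/2) ^ n *\<^sub>R y"
      using sc[of n] by (rule add_increasing[rotated])
    have "v n \<le> pprt (x n - (1/4) ^ m *\<^sub>R x m)"
      unfolding v_def diff_diff_eq by (intro pprt_mono diff_left_mono *)
    also have "\<dots> \<le> pprt (4 ^ m *\<^sub>R (x n - (1/4) ^ m *\<^sub>R x m))"
      by (rule pprt_le_pprt_scaleR) simp
    also have "4 ^ m *\<^sub>R (x n - (1/4) ^ m *\<^sub>R x m) = 4 ^ m *\<^sub>R x n - x m"
      by (simp add: scaleR_diff_right flip: power_mult_distrib)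
    finally show "v n \<le> pprt (4 ^ m *\<^sub>R x n - x m)" .
    have "4 ^ m *\<^sub>R x n \<le> 4 ^ m *\<^sub>R s m + (1/2) ^ m *\<^sub>R y"
      using scaleR_left_mono[OF s_ge[OF nm], of "4 ^ m"] y_nn
      by (intro add_increasing2) (auto simp: scaleR_nonneg_nonneg)
    then have "x m - (4 ^ m *\<^sub>R s m + (1/2) ^ m *\<^sub>R y) \<le> x m - 4 ^ m *\<^sub>R x n"
      by (rule diff_left_mono)
    then show "v m \<le> pprt (- (4 ^ m *\<^sub>R x n - x m))"
      unfolding v_def diff_diff_eq by (simp only: pprt_mono minus_diff_eq)
  qed (simp_all add: v_def)
  have "norm (v n) \<le> M" for n
    using norm_mono_nonneg[OF _ v_le, of n] x(2)[of n] by (simp add: v_def)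
  then have "bounded (range v)" by (auto simp: bounded_iff)
  then have Tv: "(\<lambda>n. norm (T (v n))) \<longlonglongrightarrow> 0"
    by (rule null[OF _ _ disj]) (simp add: v_def)
  \<comment> \<open>Omitting the \<open>y\<close> term from \<open>v n\<close> costs at most
    \<open>(1/2) ^ n *\<^sub>R T y\<close> under \<open>T\<close>, so the lower bound
    \<open>e\<close> survives in the limit and contradicts \<open>Tv\<close>.\<close>
  have le: "e \<le> norm (T (v n)) + (1/2) ^ n * norm (T y)" for n
  proof -
    define w where "w = pprt (x n - 4 ^ n *\<^sub>R s n)"
    have "x n - 4 ^ n *\<^sub>R s n \<le> v n + (1/2) ^ n *\<^sub>R y"
      using le_pprt[of "x n - 4 ^ n *\<^sub>R s n - (1/2) ^ n *\<^sub>R y"]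
      unfolding v_def by (simp only: diff_le_eq)
    moreover have "0 \<le> v n + (1/2) ^ n *\<^sub>R y"
      using y_nn by (intro add_nonneg_nonneg) (auto simp: v_def scaleR_nonneg_nonneg)
    ultimately have "w \<le> v n + (1/2) ^ n *\<^sub>R y" unfolding w_def pprt_def by (rule le_supI)
    then have "0 \<le> v n + (1/2) ^ n *\<^sub>R y - w" by simp
    then have "0 \<le> T (v n + (1/2) ^ n *\<^sub>R y - w)" "0 \<le> T w"
      using T(2) by (auto simp: positive_op_def w_def)
    then have "norm (T w) \<le> norm (T (v n) + (1/2) ^ n *\<^sub>R T y)"
      by (intro norm_mono_nonneg) (simp_all add: T.add T.diff T.scaleR)
    also have "\<dots> \<le> norm (T (v n)) + norm ((1/2) ^ n *\<^sub>R T y)" by (rule norm_triangle_ineq)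
    finally show ?thesis using x(3)[of n] by (simp add: w_def)
  qed
  have "(\<lambda>n. norm (T (v n)) + (1/2) ^ n * norm (T y)) \<longlonglongrightarrow> 0 + 0 * norm (T y)"
    by (intro tendsto_add Tv tendsto_mult tendsto_const LIMSEQ_realpow_zero) auto
  then have "e \<le> 0 + 0 * norm (T y)"
    using le by (intro LIMSEQ_le_const) auto
  then show False using e by simp
qed

section \<open>Positive operators into discrete spaces and the conclusion\<close>

lemma weakly_to_bounded_linear_image:
  assumes "bounded_linear T" "weakly_to xs x"
  shows "weakly_to (\<lambda>n. T (xs n)) (T x)"
  unfolding weakly_to_def
proof (intro allI impI)
  fix f :: "'b \<Rightarrow> real" assume "bounded_linear f"
  then have "bounded_linear (\<lambda>x. f (T x))" using assms(1) by (rule bounded_linear_compose)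
  then show "(\<lambda>n. f (T (xs n))) \<longlonglongrightarrow> f (T x)"
    using assms(2)[unfolded weakly_to_def, rule_format, of "\<lambda>x. f (T x)"] by simp
qed

lemma labs_positive_op_le:
  fixes T :: "'a::banach_lattice \<Rightarrow> 'b::banach_lattice"
  assumes "bounded_linear T" "positive_op T"
  shows "labs (T x) \<le> T (labs x)"
proof (rule labs_leI)
  interpret T: bounded_linear T by (rule assms(1))
  have "0 \<le> T (labs x - x)" "0 \<le> T (labs x - (- x))"
    using assms(2) labs_ge[of x] unfolding positive_op_def by (metis diff_ge_0_iff_ge)+
  then show "T x \<le> T (labs x)" "- T x \<le> T (labs x)"
    by (simp_all only: T.diff T.neg diff_ge_0_iff_ge)
qed

lemma uaw_DP_LIMSEQ:
  assumes "uaw_DP T" "bounded (range xs)" "uaw_to xs 0"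
  shows "(\<lambda>n. norm (T (xs n))) \<longlonglongrightarrow> 0"
  using assms by (simp add: uaw_DP_def)

lemma positive_uaw_DP_imp_dunford_pettis:
  fixes T :: "'a::banach_lattice \<Rightarrow> 'b::banach_lattice"
  assumes T: "uaw_DP T" "positive_op T"
    and F: "discrete_lattice TYPE('b)" "order_continuous_norm TYPE('b)"
    and xs: "weakly_to xs 0"
  shows "(\<lambda>n. norm (T (xs n))) \<longlonglongrightarrow> 0"
proof (rule LIMSEQ_I)
  have bl: "bounded_linear T" using T(1) by (simp add: uaw_DP_def)
  interpret T: bounded_linear T by (rule bl)
  have posT: "0 \<le> T x" if "0 \<le> x" for x using T(2) that by (simp add: positive_op_def)
  fix e :: real assume e: "0 < e"
  obtain M where M: "\<And>n. norm (xs n) \<le> M"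
    using weakly_null_imp_bounded[OF xs] by (auto simp: bounded_iff)
  have null: "(\<lambda>n. norm (T (v n))) \<longlonglongrightarrow> 0"
    if "bounded (range v)" "\<And>n. 0 \<le> v n" "\<And>m n. n < m \<Longrightarrow> inf (v n) (v m) = 0" for v
    by (rule uaw_DP_LIMSEQ[OF T(1) that(1) disjoint_uaw_null[OF that(2,3)]])
  have "0 < e / 2" using e by simp
  from positive_op_almost_order_bounded[OF bl T(2) null this, where M = M]
  obtain u where u: "0 \<le> u"
    "\<And>x. 0 \<le> x \<Longrightarrow> norm x \<le> M \<Longrightarrow> norm (T (pprt (x - u))) < e / 2"
    by metis
  have "weakly_to (\<lambda>n. T (xs n)) 0"
    using weakly_to_bounded_linear_image[OF bl xs] by (simp add: T.zero)
  then have "(\<lambda>n. norm (inf (labs (T (xs n))) (T u))) \<longlonglongrightarrow> 0"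
    using posT[OF u(1)] by (rule weakly_null_inf_discrete[OF F])
  then obtain N where N: "\<And>n. n \<ge> N \<Longrightarrow> norm (inf (labs (T (xs n))) (T u)) < e / 2"
    using LIMSEQ_D[of _ 0 "e / 2"] e by fastforce
  have "norm (T (xs n)) < e" if "n \<ge> N" for n
  proof -
    define z where "z = labs (T (xs n))"
    define w where "w = T (pprt (labs (xs n) - u))"
    have "labs (xs n) \<le> u + pprt (labs (xs n) - u)"
      using le_pprt[of "labs (xs n) - u"] by (simp add: diff_le_eq add.commute)
    then have "0 \<le> T (u + pprt (labs (xs n) - u) - labs (xs n))" by (intro posT) simp
    then have "T (labs (xs n)) \<le> T u + w" by (simp add: T.add T.diff w_def)
    with labs_positive_op_le[OF bl T(2), of "xs n"] have "z \<le> T u + w"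
      unfolding z_def by (rule order_trans)
    \<comment> \<open>Being below \<open>T u + w\<close>, \<open>z\<close> equals its own truncation
      there. This splits into the truncation at \<open>T u\<close>, small for large
      \<open>n\<close>, and the part below \<open>w\<close>, small by the choice of
      \<open>u\<close>.\<close>
    then have "norm z = norm (inf z (T u + w))" by (simp add: inf_absorb1)
    also have "\<dots> \<le> norm (inf z (T u)) + norm (inf z w)"
      by (intro norm_inf_add_le) (auto simp: z_def w_def intro: posT u)
    also have "norm (inf z w) \<le> norm w"
      by (intro norm_mono_nonneg) (auto simp: z_def w_def intro: posT)
    also have "norm w < e / 2"
      using u(2)[of "labs (xs n)"] M[of n] by (simp add: w_def)
    finally show ?thesis using N[OF that] by (simp add: z_def)
  qed
  then show "\<exists>N. \<forall>n\<ge>N. norm (norm (T (xs n)) - 0) < e" by auto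
qed

theorem theorem3p5:
  fixes T :: "'a::banach_lattice \<Rightarrow> 'b::banach_lattice"
  assumes "uaw_DP T"
    and "weakly_seq_cont_lattice_ops TYPE('a)
         \<or> (discrete_lattice TYPE('a) \<and> order_continuous_norm TYPE('a))
         \<or> (positive_op T \<and> discrete_lattice TYPE('b) \<and> order_continuous_norm TYPE('b))"
  shows "dunford_pettis T"
proof -
  have "(\<lambda>n. norm (T (xs n))) \<longlonglongrightarrow> 0" if xs: "weakly_to xs 0" for xs
  proof -
    have uaw: "(\<lambda>n. norm (T (xs n))) \<longlonglongrightarrow> 0" if "uaw_to xs 0"
      by (rule uaw_DP_LIMSEQ[OF assms(1) weakly_null_imp_bounded[OF xs] that])
    from assms(2) show ?thesis
    proof (elim disjE conjE)
      assume "weakly_seq_cont_lattice_ops TYPE('a)"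
      then have "weakly_to (\<lambda>n. labs (xs n)) 0"
        using xs by (simp add: weakly_seq_cont_lattice_ops_def)
      then have "weakly_to (\<lambda>n. inf (labs (xs n)) u) 0" if "0 \<le> u" for u
        by (rule weakly_to_0_mono) (simp_all add: that)
      then show ?thesis by (intro uaw) (simp add: uaw_to_def)
    next
      assume "discrete_lattice TYPE('a)" "order_continuous_norm TYPE('a)"
      then have "weakly_to (\<lambda>n. inf (labs (xs n)) u) 0" if "0 \<le> u" for u
        by (intro weakly_to_0_of_norm weakly_null_inf_discrete xs that)
      then show ?thesis by (intro uaw) (simp add: uaw_to_def)
    next
      assume "positive_op T" "discrete_lattice TYPE('b)" "order_continuous_norm TYPE('b)"
      then show ?thesis by (rule positive_uaw_DP_imp_dunford_pettis[OF assms(1) _ _ _ xs])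
    qed
  qed
  then show ?thesis using assms(1) by (simp add: dunford_pettis_def uaw_DP_def)
qed

end
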